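(* For any constant $\delta>0$ and any $k\le n^{1/2-\delta}$, any unbiased statistical algorithm that succeeds with probability at least $2/3$ requires $\tilde{\Omega}(n^2/k^2)$ queries to solve the distributional planted bipartite $k$-clique problem.
   Context: For $1\le k\le n$ and $S\subseteq\{1,\dots,n\}$ with $|S|=k$, let $D_S$ be the distribution on $\{0,1\}^n$ where with probability $1-k/n$ the vector $x$ is uniform on $\{0,1\}^n$, and with probability $k/n$ the coordinates in $S$ are set to $1$ and the remaining coordinates are uniform and independent. The distributional planted bipartite $k$-clique problem: given access to an unknown $D_S$ (over all $k$-subsets $S$), find $S$. An unbiased statistical algorithm accesses $D_S$ only via the $\mathrm{SAMPLE}$ oracle: given any (adaptively chosen) function $h:\{0,1\}^n\to\{0,1\}$, the oracle draws a fresh independent sample $x\sim D_S$ and returns $h(x)$. Its query complexity is the number of calls to $\mathrm{SAMPLE}$; it succeeds with probability at least $2/3$ if for every $S$ it outputs $S$ with probability at least $2/3$. *)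

theory Defs
  imports "HOL-Probability.Probability"
begin

text \<open>Vectors in $\{0,1\}^n$ are functions on the coordinates \<open>{1..n}\<close>, with the dummy value
  \<^term>\<open>False\<close> at all other arguments.\<close>

type_synonym bitvec = "nat \<Rightarrow> bool"

definition cube :: "nat \<Rightarrow> bitvec set" where
  "cube n = PiE_dflt {1..n} False (\<lambda>_. UNIV)"

definition uniform_cube :: "nat \<Rightarrow> bitvec pmf" where
  "uniform_cube n = pmf_of_set (cube n)"

definition planted_cube :: "nat \<Rightarrow> nat set \<Rightarrow> bitvec pmf" where
  "planted_cube n S =
     Pi_pmf {1..n} False (\<lambda>i. if i \<in> S then return_pmf True else bernoulli_pmf (1 / 2))"

definition clique_dist :: "nat \<Rightarrow> nat set \<Rightarrow> bitvec pmf" where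
  "clique_dist n S =
     bernoulli_pmf (real (card S) / real n) \<bind>
       (\<lambda>b. if b then planted_cube n S else uniform_cube n)"

definition k_subsets :: "nat \<Rightarrow> nat \<Rightarrow> nat set set" where
  "k_subsets n k = {S. S \<subseteq> {1..n} \<and> card S = k}"

text \<open>An unbiased statistical algorithm is an adaptive decision tree: it stops with an output, or
  submits a query function to the oracle and continues according to the bit returned, or tosses
  private coins. Only the values of a query function on the cube matter.\<close>

datatype stat_alg =
    Output "nat set"
  | Sample "bitvec \<Rightarrow> bool" "bool \<Rightarrow> stat_alg"
  | Random "stat_alg pmf"

text \<open>Joint distribution of the output and of the number of oracle calls made, each call being
  answered on a fresh sample from \<open>D\<close>.\<close>

primrec run :: "bitvec pmf \<Rightarrow> stat_alg \<Rightarrow> (nat set \<times> nat) pmf" where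
  "run D (Output T) = return_pmf (T, 0)"
| "run D (Sample h f) = D \<bind> (\<lambda>x. map_pmf (apsnd Suc) (run D (f (h x))))"
| "run D (Random p) = join_pmf (map_pmf (run D) p)"

definition solves_clique :: "nat \<Rightarrow> nat \<Rightarrow> real \<Rightarrow> stat_alg \<Rightarrow> bool" where
  "solves_clique n k p A \<longleftrightarrow>
     (\<forall>S\<in>k_subsets n k. pmf (map_pmf fst (run (clique_dist n S) A)) S \<ge> p)"

text \<open>Worst case over all instances and over all runs that occur with positive probability.\<close>

definition query_complexity :: "nat \<Rightarrow> nat \<Rightarrow> stat_alg \<Rightarrow> enat" where
  "query_complexity n k A =
     (SUP S\<in>k_subsets n k. SUP r\<in>set_pmf (run (clique_dist n S) A). enat (snd r))"

end

theory Submission imports Defs begin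

text \<open>Compare each \<open>D\<^sub>S\<close> with the uniform distribution \<open>U\<close>. Under \<open>U\<close> the run does not depend on
  \<open>S\<close>, so its output equals \<open>S\<close> with average probability at most \<open>1 / (n choose k)\<close>; a successful
  algorithm must therefore accumulate a constant relative entropy between the transcripts under
  \<open>U\<close> and under \<open>D\<^sub>S\<close>, on average over \<open>S\<close>. By the chain rule this is at most the number of queries
  times the average over \<open>S\<close> of the chi-square distance of the answer to a single query \<open>h\<close>. With
  \<open>u\<^sub>S = 2\<^sup>k 1[x\<^sub>S = 1]\<close> the density of the planted part, that distance is governed by
  \<open>(k/n)\<^sup>2 E\<^sub>U[(h - E\<^sub>U h) u\<^sub>S]\<^sup>2 / Var\<^sub>U h\<close>. The Gram matrix \<open>E\<^sub>U[u\<^sub>S u\<^sub>T] = 2 ^ |S \<inter> T|\<close> has rows of average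
  at most \<open>(1 + k/n)\<^sup>k \<le> e\<close> when \<open>k\<^sup>2 \<le> n\<close>, so by the Schur test a query is worth \<open>O(k\<^sup>2/n\<^sup>2)\<close>, and
  \<open>\<Omega>(n\<^sup>2/k\<^sup>2)\<close> queries are needed, without logarithmic loss.\<close>

section \<open>Relative entropy along a decision tree\<close>

lemma integrable_pmf_bounded:
  fixes f :: "'a \<Rightarrow> real"
  assumes "\<And>x. \<bar>f x\<bar> \<le> B"
  shows "integrable (measure_pmf p) f"
  by (rule measure_pmf.integrable_const_bound[where B = B]) (use assms in auto)

lemma expectation_bind_pmf:
  fixes f :: "'b \<Rightarrow> real"
  assumes "\<And>y. \<bar>f y\<bar> \<le> B"
  shows "measure_pmf.expectation (p \<bind> N) f
    = measure_pmf.expectation p (\<lambda>x. measure_pmf.expectation (N x) f)"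
  unfolding measure_pmf_bind
  by (rule integral_bind[where K = "count_space UNIV" and B = B and B' = 1])
    (use assms in \<open>auto simp: measure_pmf.finite_measure_axioms measure_pmf.emeasure_space_le_1
       space_subprob_algebra measure_pmf.subprob_space_axioms\<close>)

text \<open>An oracle answer is a biased bit, so a query enters the argument only through the
  probability that it returns \<open>True\<close>.\<close>

lemma expectation_bool_image_pmf:
  fixes F :: "bool \<Rightarrow> real"
  shows "measure_pmf.expectation D (\<lambda>x. F (h x))
    = measure_pmf.prob D {x. h x} * F True + (1 - measure_pmf.prob D {x. h x}) * F False"
proof -
  have "measure_pmf.expectation D (\<lambda>x. F (h x))
    = measure_pmf.expectation D (\<lambda>x. F False + (F True - F False) * indicator {x. h x} x)"
    by (intro Bochner_Integration.integral_cong refl) (auto simp: indicator_def)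
  also have "\<dots> = F False + (F True - F False) * measure_pmf.prob D {x. h x}"
    by (simp add: measure_pmf.emeasure_eq_measure)
  finally show ?thesis
    by (simp add: algebra_simps)
qed

lemma expectation_run_Sample:
  fixes \<phi> :: "nat set \<Rightarrow> real"
  assumes "\<And>T. \<bar>\<phi> T\<bar> \<le> B"
  shows "measure_pmf.expectation (run D (Sample h f)) (\<lambda>r. \<phi> (fst r))
    = measure_pmf.prob D {x. h x} * measure_pmf.expectation (run D (f True)) (\<lambda>r. \<phi> (fst r))
      + (1 - measure_pmf.prob D {x. h x})
        * measure_pmf.expectation (run D (f False)) (\<lambda>r. \<phi> (fst r))"
  using assms
    expectation_bool_image_pmf[of D "\<lambda>b. measure_pmf.expectation (run D (f b)) (\<lambda>r. \<phi> (fst r))" h]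
  by (simp add: expectation_bind_pmf[where B = B])

lemma expectation_run_Random:
  fixes \<phi> :: "nat set \<Rightarrow> real"
  assumes "\<And>T. \<bar>\<phi> T\<bar> \<le> B"
  shows "measure_pmf.expectation (run D (Random p)) (\<lambda>r. \<phi> (fst r))
    = measure_pmf.expectation p (\<lambda>A. measure_pmf.expectation (run D A) (\<lambda>r. \<phi> (fst r)))"
  using assms by (simp add: bind_eq_join_pmf[symmetric] expectation_bind_pmf[where B = B])

text \<open>The tangent to \<open>ln\<close> at the mean \<open>m\<close> lies above the graph:
  \<open>ln y \<le> ln m - 1 + y / m\<close>. The bounds \<open>a\<close> and \<open>b\<close> give
  integrability and \<open>m > 0\<close> even for coins with infinite support.\<close>

lemma expectation_ln_le:
  fixes X :: "'a \<Rightarrow> real"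
  assumes "0 < a" "\<And>x. a \<le> X x" "\<And>x. X x \<le> b"
  shows "measure_pmf.expectation p (\<lambda>x. ln (X x)) \<le> ln (measure_pmf.expectation p X)"
proof -
  define m where "m = measure_pmf.expectation p X"
  have intX: "integrable (measure_pmf p) X"
  proof (rule integrable_pmf_bounded[where B = b])
    show "\<bar>X x\<bar> \<le> b" for x
      using assms(1) assms(2)[of x] assms(3)[of x] by linarith
  qed
  have lnX: "integrable (measure_pmf p) (\<lambda>x. ln (X x))"
  proof (rule integrable_pmf_bounded[where B = "\<bar>ln a\<bar> + \<bar>ln b\<bar>"])
    show "\<bar>ln (X x)\<bar> \<le> \<bar>ln a\<bar> + \<bar>ln b\<bar>" for x
    proof -
      have "0 < X x" using assms(1) assms(2)[of x] by linarith
      moreover have "ln a \<le> ln (X x)" using assms(1) assms(2)[of x] by simp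
      moreover have "ln (X x) \<le> ln b" using calculation(1) assms(3)[of x] by simp
      ultimately show ?thesis by linarith
    qed
  qed
  have "measure_pmf.expectation p (\<lambda>_. a) \<le> m"
    unfolding m_def by (intro integral_mono intX assms) auto
  hence m: "0 < m" using assms(1) by simp
  have "measure_pmf.expectation p (\<lambda>x. ln (X x))
      \<le> measure_pmf.expectation p (\<lambda>x. (ln m - 1) + X x / m)"
  proof (intro integral_mono lnX)
    show "integrable (measure_pmf p) (\<lambda>x. (ln m - 1) + X x / m)"
      using intX by auto
    show "ln (X x) \<le> (ln m - 1) + X x / m" for x
    proof -
      have "0 < X x" using assms(1) assms(2)[of x] by linarith
      hence "ln (X x / m) \<le> X x / m - 1" using m by (intro ln_le_minus_one) auto
      thus ?thesis using \<open>0 < X x\<close> m by (simp add: ln_div)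
    qed
  qed
  also have "\<dots> = (ln m - 1) + m / m"
    using intX by (subst Bochner_Integration.integral_add) (auto simp: m_def)
  finally show ?thesis using m by (simp add: m_def)
qed

text \<open>Concavity of the logarithm, after writing the mixture with weights \<open>p\<close> as one with weights
  \<open>p\<^sub>0\<close>; the loss is the relative entropy of the two biased bits, bounded by \<open>ln x \<le> x - 1\<close>. For
  \<open>p \<in> {0, 1}\<close> the quotient is \<open>x / 0 = 0\<close>.\<close>

lemma ln_mixture_change_weights:
  fixes X Y p p\<^sub>0 :: real
  assumes "0 < X" "0 < Y" and p0: "0 \<le> p\<^sub>0" "p\<^sub>0 \<le> 1" and p: "0 \<le> p" "p \<le> 1"
    and "p = 0 \<longleftrightarrow> p\<^sub>0 = 0" "p = 1 \<longleftrightarrow> p\<^sub>0 = 1"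
  shows "p\<^sub>0 * ln X + (1 - p\<^sub>0) * ln Y \<le> ln (p * X + (1 - p) * Y) + (p - p\<^sub>0)\<^sup>2 / (p * (1 - p))"
proof (cases "p\<^sub>0 = 0 \<or> p\<^sub>0 = 1")
  case True
  hence "p = p\<^sub>0" using assms(7,8) by metis
  thus ?thesis using True by (elim disjE) simp_all
next
  case False
  hence p0: "0 < p\<^sub>0" "p\<^sub>0 < 1" and p: "0 < p" "p < 1" using assms by (simp_all add: less_le)
  define m where "m = p * X + (1 - p) * Y"
  have m: "0 < m" unfolding m_def using p assms(1,2) by (intro add_pos_pos mult_pos_pos) simp_all
  \<comment> \<open>\<open>Z / m\<close> is the posterior weight \<open>s * Z / m\<close> relative
    to \<open>s\<^sub>0\<close>, times the likelihood ratio \<open>s\<^sub>0 / s\<close>. With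
    \<open>ln x \<le> x - 1\<close> on both factors, the posterior weights of the two branches add
    up to 1 and the ratios leave the chi-square term.\<close>
  have ln_le: "s\<^sub>0 * ln (Z / m) \<le> s * Z / m - s\<^sub>0 + (s\<^sub>0\<^sup>2 / s - s\<^sub>0)"
    if "0 < s\<^sub>0" "0 < s" "0 < Z" for s\<^sub>0 s Z :: real
  proof -
    have pos: "0 < s * Z / (s\<^sub>0 * m)" "0 < s\<^sub>0 / s" using that m by simp_all
    have "Z / m = (s * Z / (s\<^sub>0 * m)) * (s\<^sub>0 / s)" using that m by simp
    hence "ln (Z / m) = ln (s * Z / (s\<^sub>0 * m)) + ln (s\<^sub>0 / s)" using pos ln_mult_pos by metis
    also have "\<dots> \<le> (s * Z / (s\<^sub>0 * m) - 1) + (s\<^sub>0 / s - 1)"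
      by (intro add_mono ln_le_minus_one pos)
    finally have "s\<^sub>0 * ln (Z / m) \<le> s\<^sub>0 * ((s * Z / (s\<^sub>0 * m) - 1) + (s\<^sub>0 / s - 1))"
      using that by simp
    also have "\<dots> = s * Z / m - s\<^sub>0 + (s\<^sub>0\<^sup>2 / s - s\<^sub>0)"
      using that m by (simp add: distrib_left right_diff_distrib power2_eq_square)
    finally show ?thesis .
  qed
  have "p\<^sub>0 * ln (X / m) + (1 - p\<^sub>0) * ln (Y / m)
      \<le> (p * X / m - p\<^sub>0 + (p\<^sub>0\<^sup>2 / p - p\<^sub>0))
        + ((1 - p) * Y / m - (1 - p\<^sub>0) + ((1 - p\<^sub>0)\<^sup>2 / (1 - p) - (1 - p\<^sub>0)))"
    using p p0 assms(1,2) by (intro add_mono ln_le) simp_all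
  also have "\<dots> = (p * X / m + (1 - p) * Y / m - 1) + (p\<^sub>0\<^sup>2 / p + (1 - p\<^sub>0)\<^sup>2 / (1 - p) - 1)"
    by simp
  also have "p * X / m + (1 - p) * Y / m - 1 = 0"
    using m by (simp add: m_def flip: add_divide_distrib)
  also have "p\<^sub>0\<^sup>2 / p + (1 - p\<^sub>0)\<^sup>2 / (1 - p) - 1 = (p - p\<^sub>0)\<^sup>2 / (p * (1 - p))"
  proof -
    have "p \<noteq> 0" "1 - p \<noteq> 0" using p by simp_all
    hence "p\<^sub>0\<^sup>2 / p + (1 - p\<^sub>0)\<^sup>2 / (1 - p) - 1
        = (p\<^sub>0\<^sup>2 * (1 - p) + (1 - p\<^sub>0)\<^sup>2 * p - p * (1 - p)) / (p * (1 - p))"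
      by (simp add: add_divide_distrib diff_divide_distrib)
    also have "p\<^sub>0\<^sup>2 * (1 - p) + (1 - p\<^sub>0)\<^sup>2 * p - p * (1 - p) = (p - p\<^sub>0)\<^sup>2"
      by algebra
    finally show ?thesis .
  qed
  finally show ?thesis
    using assms(1,2) m by (simp add: ln_div m_def algebra_simps)
qed

text \<open>Null events and almost sure events depend only on the support. This gives the side
  conditions on 0 and 1 in \<open>ln_mixture_change_weights\<close>.\<close>

lemma prob_eq_0_or_1_cong:
  assumes "set_pmf D = set_pmf U"
  shows "measure_pmf.prob D E = 0 \<longleftrightarrow> measure_pmf.prob U E = 0"
    and "measure_pmf.prob D E = 1 \<longleftrightarrow> measure_pmf.prob U E = 1"
  using assms by (auto simp: measure_pmf_zero_iff measure_pmf.prob_eq_1 AE_measure_pmf_iff)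

text \<open>Query complexity is measured on runs against \<open>clique_dist\<close>, while the
  induction follows runs against the uniform distribution; equal supports transfer the
  bound.\<close>

lemma set_pmf_run_cong:
  assumes "set_pmf D = set_pmf U"
  shows "set_pmf (run D A) = set_pmf (run U A)"
  by (induction A) (auto simp: assms)

text \<open>The summand is at most the relative entropy of the two transcripts, by the variational formula
  with test function \<open>ln w\<close>, so it obeys the same chain rule along the decision tree.\<close>

lemma sum_entropy_gap_le:
  fixes D :: "'i \<Rightarrow> bitvec pmf" and w :: "'i \<Rightarrow> nat set \<Rightarrow> real"
  assumes "0 < a" and w: "\<And>i T. a \<le> w i T" "\<And>i T. w i T \<le> b"
    and supp: "\<And>i. i \<in> I \<Longrightarrow> set_pmf (D i) = set_pmf U"
    and chi: "\<And>h. (\<Sum>i\<in>I. (measure_pmf.prob (D i) {x. h x} - measure_pmf.prob U {x. h x})\<^sup>2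
        / (measure_pmf.prob (D i) {x. h x} * (1 - measure_pmf.prob (D i) {x. h x}))) \<le> E"
    and q: "\<And>r. r \<in> set_pmf (run U A) \<Longrightarrow> snd r \<le> q"
  shows "(\<Sum>i\<in>I. measure_pmf.expectation (run U A) (\<lambda>r. ln (w i (fst r)))
      - ln (measure_pmf.expectation (run (D i) A) (\<lambda>r. w i (fst r)))) \<le> real q * E"
  using q
\<comment> \<open>The sum over \<open>i\<close> stays inside the induction because
  \<open>chi\<close> controls only the sum, for a query common to all \<open>i\<close>. The budget
  \<open>q\<close> varies because a branch has one query less.\<close>
proof (induction A arbitrary: q)
  have E: "0 \<le> E" using chi[of "\<lambda>_. True"] by simp
  define L where "L i A = measure_pmf.expectation (run U A) (\<lambda>r. ln (w i (fst r)))" for i A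
  define W where "W i A = measure_pmf.expectation (run (D i) A) (\<lambda>r. w i (fst r))" for i A
  define C where "C = \<bar>ln a\<bar> + \<bar>ln b\<bar>"
  have wB: "\<bar>w i T\<bar> \<le> b" for i T
    using \<open>0 < a\<close> w(1)[of i T] w(2)[of i T] by linarith
  have lnB: "\<bar>ln y\<bar> \<le> C" if "a \<le> y" "y \<le> b" for y
  proof -
    have "ln a \<le> ln y" "ln y \<le> ln b" using that \<open>0 < a\<close> by auto
    thus ?thesis unfolding C_def by linarith
  qed
  have Wbounds: "a \<le> W i A" "W i A \<le> b" for i A
  proof -
    have int: "integrable (measure_pmf (run (D i) A)) (\<lambda>r. w i (fst r))"
      by (rule integrable_pmf_bounded[where B = b]) (rule wB)
    have "measure_pmf.expectation (run (D i) A) (\<lambda>_. a) \<le> W i A"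
      unfolding W_def by (intro integral_mono int w) auto
    thus "a \<le> W i A" by simp
    have "W i A \<le> measure_pmf.expectation (run (D i) A) (\<lambda>_. b)"
      unfolding W_def by (intro integral_mono int w) auto
    thus "W i A \<le> b" by simp
  qed
  have Wpos: "0 < W i A" for i A using Wbounds(1)[of i A] \<open>0 < a\<close> by linarith
  have Lbound: "\<bar>L i A\<bar> \<le> C" for i A
  proof -
    have "\<bar>L i A\<bar> \<le> measure_pmf.expectation (run U A) (\<lambda>r. \<bar>ln (w i (fst r))\<bar>)"
      unfolding L_def by (rule integral_abs_bound)
    also have "\<dots> \<le> measure_pmf.expectation (run U A) (\<lambda>_. C)"
      by (intro integral_mono integrable_pmf_bounded[where B = C])
        (use lnB[OF w] in \<open>simp_all add: C_def\<close>)
    finally show ?thesis by simp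
  qed
  {
    case (Output T)
    show ?case using E by simp
  next
    case (Sample h f)
    define p where "p D = measure_pmf.prob D {x. h x}" for D
    have p: "0 \<le> p D" "p D \<le> 1" for D unfolding p_def by simp_all
    \<comment> \<open>Only branches reachable under \<open>U\<close> inherit a query budget; the
      others have weight zero in \<open>bt\<close> and \<open>bf\<close>.\<close>
    have reach: "Suc (snd r) \<le> q" if "b \<in> h ` set_pmf U" "r \<in> set_pmf (run U (f b))" for b r
    proof -
      have "apsnd Suc r \<in> set_pmf (run U (Sample h f))" using that by auto
      from Sample.prems[OF this] show ?thesis by simp
    qed
    \<comment> \<open>Some run passes through this query, so \<open>q\<close> is positive and the
      natural subtraction \<open>q - 1\<close> is exact.\<close>
    obtain x where "x \<in> set_pmf U" using set_pmf_not_empty[of U] by blast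
    moreover obtain r where "r \<in> set_pmf (run U (f (h x)))"
      using set_pmf_not_empty[of "run U (f (h x))"] by auto
    ultimately have q1: "1 \<le> q" using reach[of "h x" r] by simp
    have branch: "(\<Sum>i\<in>I. L i (f b) - ln (W i (f b))) \<le> real (q - 1) * E"
      if "b \<in> h ` set_pmf U" for b
      unfolding L_def W_def by (rule Sample.IH) (use reach[OF that] in \<open>force+\<close>)
    have bt: "p U * (\<Sum>i\<in>I. L i (f True) - ln (W i (f True))) \<le> p U * (real (q - 1) * E)"
    proof (cases "True \<in> h ` set_pmf U")
      case False
      hence "p U = 0" by (auto simp: p_def measure_pmf_zero_iff)
      thus ?thesis by simp
    qed (use branch p in \<open>auto intro!: mult_left_mono\<close>)
    have bf: "(1 - p U) * (\<Sum>i\<in>I. L i (f False) - ln (W i (f False)))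
        \<le> (1 - p U) * (real (q - 1) * E)"
    proof (cases "False \<in> h ` set_pmf U")
      case False
      hence "p U = 1" by (auto simp: p_def measure_pmf.prob_eq_1 AE_measure_pmf_iff)
      thus ?thesis by simp
    qed (use branch p in \<open>auto intro!: mult_left_mono\<close>)
    \<comment> \<open>Chain rule: \<open>L\<close> mixes the branches with the weights of
      \<open>U\<close> and \<open>W\<close> with those of \<open>D i\<close>; passing to common
      weights costs one chi-square term per \<open>i\<close>.\<close>
    have "(\<Sum>i\<in>I. L i (Sample h f) - ln (W i (Sample h f)))
      \<le> (\<Sum>i\<in>I. p U * (L i (f True) - ln (W i (f True)))
          + (1 - p U) * (L i (f False) - ln (W i (f False)))
          + (p (D i) - p U)\<^sup>2 / (p (D i) * (1 - p (D i))))"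
    proof (rule sum_mono)
      fix i assume i: "i \<in> I"
      have L: "L i (Sample h f) = p U * L i (f True) + (1 - p U) * L i (f False)"
        unfolding L_def p_def by (rule expectation_run_Sample[where B = C]) (intro lnB w)
      have W: "W i (Sample h f) = p (D i) * W i (f True) + (1 - p (D i)) * W i (f False)"
        unfolding W_def p_def by (rule expectation_run_Sample[where B = b]) (rule wB)
      have "p U * ln (W i (f True)) + (1 - p U) * ln (W i (f False))
        \<le> ln (p (D i) * W i (f True) + (1 - p (D i)) * W i (f False))
          + (p (D i) - p U)\<^sup>2 / (p (D i) * (1 - p (D i)))"
        using prob_eq_0_or_1_cong[OF supp[OF i], of "{x. h x}"]
        by (intro ln_mixture_change_weights Wpos p) (simp_all add: p_def)
      then show "L i (Sample h f) - ln (W i (Sample h f))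
        \<le> p U * (L i (f True) - ln (W i (f True)))
          + (1 - p U) * (L i (f False) - ln (W i (f False)))
          + (p (D i) - p U)\<^sup>2 / (p (D i) * (1 - p (D i)))"
        unfolding L W right_diff_distrib[where c = "ln _"] by linarith
    qed
    also have "\<dots> = p U * (\<Sum>i\<in>I. L i (f True) - ln (W i (f True)))
        + (1 - p U) * (\<Sum>i\<in>I. L i (f False) - ln (W i (f False)))
        + (\<Sum>i\<in>I. (p (D i) - p U)\<^sup>2 / (p (D i) * (1 - p (D i))))"
      by (simp add: sum.distrib sum_distrib_left)
    also have "\<dots> \<le> p U * (real (q - 1) * E) + (1 - p U) * (real (q - 1) * E) + E"
      using bt bf chi[of h] by (auto simp: p_def intro!: add_mono)
    also have "\<dots> = real q * E"
      using q1 by (simp add: of_nat_diff algebra_simps)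
    finally show ?case by (simp only: L_def W_def)
  next
    case (Random P)
    have IH: "(\<Sum>i\<in>I. L i A - ln (W i A)) \<le> real q * E" if "A \<in> set_pmf P" for A
      unfolding L_def W_def using that Random.prems by (intro Random.IH) auto
    have int: "integrable (measure_pmf P) (\<lambda>A. L i A)"
      "integrable (measure_pmf P) (\<lambda>A. ln (W i A))" for i
      by (rule integrable_pmf_bounded[where B = C], intro Lbound lnB Wbounds)+
    have "(\<Sum>i\<in>I. L i (Random P) - ln (W i (Random P)))
      \<le> (\<Sum>i\<in>I. measure_pmf.expectation P (\<lambda>A. L i A - ln (W i A)))"
    proof (rule sum_mono)
      fix i
      have "L i (Random P) = measure_pmf.expectation P (L i)"
        unfolding L_def by (rule expectation_run_Random[where B = C]) (intro lnB w)
      moreover have "W i (Random P) = measure_pmf.expectation P (W i)"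
        unfolding W_def by (rule expectation_run_Random[where B = b]) (rule wB)
      \<comment> \<open>Jensen has the favourable sign: revealing the private coins can only enlarge
        the gap.\<close>
      moreover have "measure_pmf.expectation P (\<lambda>A. ln (W i A))
          \<le> ln (measure_pmf.expectation P (W i))"
        by (rule expectation_ln_le[OF \<open>0 < a\<close> Wbounds])
      ultimately show "L i (Random P) - ln (W i (Random P))
          \<le> measure_pmf.expectation P (\<lambda>A. L i A - ln (W i A))"
        by (simp add: int)
    qed
    also have "\<dots> = measure_pmf.expectation P (\<lambda>A. \<Sum>i\<in>I. L i A - ln (W i A))"
      by (subst Bochner_Integration.integral_sum) (auto intro: int)
    also have "\<dots> \<le> measure_pmf.expectation P (\<lambda>_. real q * E)"
      by (intro integral_mono_AE Bochner_Integration.integrable_sum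
          Bochner_Integration.integrable_diff int) (simp_all add: AE_measure_pmf_iff IH)
    finally show ?case by (simp add: L_def W_def)
  }
qed

section \<open>Correlations of planted distributions\<close>

text \<open>Schur test for the Gram matrix of the \<open>u\<^sub>i\<close>; the positive square is that of
  \<open>R g - (\<Sum>i. E[g u\<^sub>i] u\<^sub>i)\<close>.\<close>

lemma sum_correlation_sq_le:
  fixes u :: "'i \<Rightarrow> 'a \<Rightarrow> real" and g :: "'a \<Rightarrow> real"
  assumes "finite (set_pmf U)" "finite I" "0 < R"
    and gram: "\<And>i j. i \<in> I \<Longrightarrow> j \<in> I \<Longrightarrow> 0 \<le> measure_pmf.expectation U (\<lambda>x. u i x * u j x)"
    and row: "\<And>i. i \<in> I \<Longrightarrow> (\<Sum>j\<in>I. measure_pmf.expectation U (\<lambda>x. u i x * u j x)) \<le> R"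
  shows "(\<Sum>i\<in>I. (measure_pmf.expectation U (\<lambda>x. g x * u i x))\<^sup>2)
    \<le> R * measure_pmf.expectation U (\<lambda>x. (g x)\<^sup>2)"
proof -
  define E where "E f = measure_pmf.expectation U f" for f :: "'a \<Rightarrow> real"
  have int: "integrable (measure_pmf U) f" for f :: "'a \<Rightarrow> real"
    by (rule integrable_measure_pmf_finite) fact
  have E_add: "E (\<lambda>x. f x + f' x) = E f + E f'" for f f'
    unfolding E_def by (simp add: int)
  have E_sum: "E (\<lambda>x. \<Sum>i\<in>I. f i x) = (\<Sum>i\<in>I. E (f i))" for f
    unfolding E_def by (simp add: int)
  have E_mult: "E (\<lambda>x. c * f x) = c * E f" for c f
    unfolding E_def by simp
  define a where "a i = E (\<lambda>x. g x * u i x)" for i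
  define G where "G i j = E (\<lambda>x. u i x * u j x)" for i j
  have G_commute: "G i j = G j i" for i j
    unfolding G_def by (simp add: mult.commute)
  define V where "V x = (\<Sum>i\<in>I. a i * u i x)" for x
  define Q where "Q = (\<Sum>i\<in>I. (a i)\<^sup>2)"
  have "E (\<lambda>x. g x * V x) = E (\<lambda>x. \<Sum>i\<in>I. a i * (g x * u i x))"
    unfolding V_def by (simp add: sum_distrib_left mult_ac)
  hence gV: "E (\<lambda>x. g x * V x) = Q"
    by (simp add: E_sum E_mult a_def Q_def power2_eq_square)
  have "E (\<lambda>x. V x * V x) = E (\<lambda>x. \<Sum>i\<in>I. \<Sum>j\<in>I. (a i * a j) * (u i x * u j x))"
    unfolding V_def by (simp add: sum_product mult_ac)
  also have "\<dots> = (\<Sum>i\<in>I. \<Sum>j\<in>I. (a i * a j) * G i j)"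
    by (simp only: E_sum E_mult G_def)
  \<comment> \<open>The quadratic form is reduced to row sums: AM-GM separates \<open>a i\<close>
    from \<open>a j\<close>, since Gram entries are nonnegative, and symmetry makes both halves
    equal.\<close>
  also have "\<dots> \<le> (\<Sum>i\<in>I. \<Sum>j\<in>I. ((a i)\<^sup>2 / 2 + (a j)\<^sup>2 / 2) * G i j)"
  proof (intro sum_mono mult_right_mono)
    show "a i * a j \<le> (a i)\<^sup>2 / 2 + (a j)\<^sup>2 / 2" for i j
      using sum_squares_bound[of "a i" "a j"] by simp
    show "0 \<le> G i j" if "i \<in> I" "j \<in> I" for i j
      using gram[OF that] by (simp add: G_def E_def)
  qed
  also have "\<dots> = (\<Sum>i\<in>I. \<Sum>j\<in>I. (a i)\<^sup>2 / 2 * G i j) + (\<Sum>i\<in>I. \<Sum>j\<in>I. (a j)\<^sup>2 / 2 * G i j)"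
    by (simp only: distrib_right sum.distrib)
  also have "(\<Sum>i\<in>I. \<Sum>j\<in>I. (a j)\<^sup>2 / 2 * G i j) = (\<Sum>i\<in>I. \<Sum>j\<in>I. (a i)\<^sup>2 / 2 * G i j)"
    by (subst sum.swap) (simp only: G_commute)
  also have "(\<Sum>i\<in>I. \<Sum>j\<in>I. (a i)\<^sup>2 / 2 * G i j) + (\<Sum>i\<in>I. \<Sum>j\<in>I. (a i)\<^sup>2 / 2 * G i j)
      = (\<Sum>i\<in>I. (a i)\<^sup>2 * (\<Sum>j\<in>I. G i j))"
    by (simp add: sum_distrib_left sum_distrib_right mult.commute flip: sum.distrib)
  also have "\<dots> \<le> (\<Sum>i\<in>I. (a i)\<^sup>2 * R)"
    using row by (intro sum_mono mult_left_mono) (simp_all add: G_def E_def)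
  finally have VV: "E (\<lambda>x. V x * V x) \<le> Q * R"
    by (simp add: Q_def sum_distrib_right)
  have "0 \<le> E (\<lambda>x. (R * g x - V x)\<^sup>2)"
    unfolding E_def by (rule integral_nonneg_AE) simp
  also have "(\<lambda>x. (R * g x - V x)\<^sup>2) = (\<lambda>x. R\<^sup>2 * (g x)\<^sup>2 + (- 2 * R * (g x * V x) + V x * V x))"
    by (rule ext) algebra
  also have "E \<dots> = R\<^sup>2 * E (\<lambda>x. (g x)\<^sup>2) + (- 2 * R * Q + E (\<lambda>x. V x * V x))"
    by (simp only: E_add E_mult gV)
  also have "\<dots> \<le> R * (R * E (\<lambda>x. (g x)\<^sup>2) - Q)"
    using VV by (simp add: power2_eq_square algebra_simps)
  finally have "0 \<le> R * E (\<lambda>x. (g x)\<^sup>2) - Q"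
    using \<open>0 < R\<close> by (simp add: zero_le_mult_iff)
  thus ?thesis by (simp add: Q_def a_def E_def)
qed

section \<open>The planted density on the cube\<close>

lemma finite_cube: "finite (cube n)"
  unfolding cube_def by (rule finite_PiE_dflt) auto

lemma card_cube: "card (cube n) = 2 ^ n"
  unfolding cube_def by (subst card_PiE_dflt) auto

lemma cube_nonempty: "cube n \<noteq> {}"
  using card_cube[of n] by force

lemma set_pmf_uniform_cube: "set_pmf (uniform_cube n) = cube n"
  unfolding uniform_cube_def by (rule set_pmf_of_set[OF cube_nonempty finite_cube])

lemma pmf_uniform_cube: "x \<in> cube n \<Longrightarrow> pmf (uniform_cube n) x = 1 / 2 ^ n"
  unfolding uniform_cube_def
  by (subst pmf_of_set[OF cube_nonempty finite_cube]) (simp add: card_cube)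

text \<open>Defined for sets of any size, so that a product of two densities is a multiple of the
  density of the union.\<close>

definition planted_density :: "nat set \<Rightarrow> bitvec \<Rightarrow> real" where
  "planted_density S x = 2 ^ card S * of_bool (\<forall>i\<in>S. x i)"

lemma planted_density_nonneg: "0 \<le> planted_density S x"
  by (simp add: planted_density_def)

lemma planted_density_mult:
  assumes "finite S" "finite T"
  shows "planted_density S x * planted_density T x = 2 ^ card (S \<inter> T) * planted_density (S \<union> T) x"
proof -
  have "(2::real) ^ card S * 2 ^ card T = 2 ^ card (S \<inter> T) * 2 ^ card (S \<union> T)"
    using card_Un_Int[OF assms] by (simp flip: power_add add: add.commute)
  thus ?thesis by (auto simp: planted_density_def)
qed

lemma set_pmf_planted_cube: "set_pmf (planted_cube n S) \<subseteq> cube n"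
  unfolding planted_cube_def cube_def
  using set_Pi_pmf_subset[of "{1..n}" False] by (auto simp: PiE_dflt_def)

lemma pmf_planted_cube:
  assumes "S \<subseteq> {1..n}" "x \<in> cube n"
  shows "pmf (planted_cube n S) x = pmf (uniform_cube n) x * planted_density S x"
proof -
  have fin: "finite S" using assms(1) finite_subset by blast
  have card: "card S \<le> n" using card_mono[OF _ assms(1)] by simp
  have "pmf (planted_cube n S) x = (\<Prod>i\<in>{1..n}. if i \<in> S then of_bool (x i) else 1 / 2)"
    unfolding planted_cube_def
    by (subst pmf_Pi') (use assms(2) in \<open>auto simp: cube_def PiE_dflt_def intro!: prod.cong\<close>)
  also have "\<dots> = (\<Prod>i\<in>{1..n} \<inter> S. of_bool (x i)) * (\<Prod>i\<in>{1..n} - S. 1 / 2)"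
    by (subst prod.If_cases) (simp_all add: Diff_eq)
  also have "{1..n} \<inter> S = S" using assms(1) by blast
  also have "(\<Prod>i\<in>S. of_bool (x i)) = (of_bool (\<forall>i\<in>S. x i) :: real)"
    using fin by (auto simp: prod_zero_iff)
  also have "(\<Prod>i\<in>{1..n} - S. 1 / 2) = (1 / 2 :: real) ^ (n - card S)"
    using assms(1) fin by (simp add: card_Diff_subset)
  also have "(1 / 2 :: real) ^ (n - card S) = 2 ^ card S / 2 ^ n"
    using card by (simp add: power_diff power_one_over)
  finally show ?thesis
    using assms(2) by (simp add: pmf_uniform_cube planted_density_def)
qed

lemma expectation_planted_cube:
  fixes f :: "bitvec \<Rightarrow> real"
  assumes "S \<subseteq> {1..n}"
  shows "measure_pmf.expectation (planted_cube n S) f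
    = measure_pmf.expectation (uniform_cube n) (\<lambda>x. f x * planted_density S x)"
proof -
  have "measure_pmf.expectation (planted_cube n S) f
      = (\<Sum>x\<in>cube n. f x * pmf (planted_cube n S) x)"
    using set_pmf_planted_cube by (intro integral_measure_pmf_real finite_cube) blast
  also have "\<dots> = (\<Sum>x\<in>cube n. f x * planted_density S x * pmf (uniform_cube n) x)"
    by (intro sum.cong refl) (simp add: pmf_planted_cube[OF assms])
  also have "\<dots> = measure_pmf.expectation (uniform_cube n) (\<lambda>x. f x * planted_density S x)"
    by (intro integral_measure_pmf_real[symmetric] finite_cube) (simp add: set_pmf_uniform_cube)
  finally show ?thesis .
qed

lemma expectation_planted_density:
  assumes "S \<subseteq> {1..n}"
  shows "measure_pmf.expectation (uniform_cube n) (planted_density S) = 1"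
  using expectation_planted_cube[OF assms, of "\<lambda>_. 1"] by simp

text \<open>The density of \<open>S \<union> T\<close> integrates to 1, which leaves only the factor
  from the coordinates planted twice.\<close>

lemma expectation_planted_density_mult:
  assumes "S \<subseteq> {1..n}" "T \<subseteq> {1..n}"
  shows "measure_pmf.expectation (uniform_cube n)
    (\<lambda>x. planted_density S x * planted_density T x) = 2 ^ card (S \<inter> T)"
proof -
  have "finite S" "finite T" using assms finite_subset by blast+
  thus ?thesis
    using assms by (simp add: planted_density_mult expectation_planted_density)
qed

lemma prob_clique_dist:
  assumes "card S \<le> n"
  shows "measure_pmf.prob (clique_dist n S) E
    = (1 - card S / n) * measure_pmf.prob (uniform_cube n) E
      + card S / n * measure_pmf.prob (planted_cube n S) E"
proof -
  have "measure_pmf.prob (clique_dist n S) E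
      = measure_pmf.expectation (clique_dist n S) (indicator E)"
    by simp
  also have "\<dots> = measure_pmf.expectation (bernoulli_pmf (card S / n))
      (\<lambda>b. measure_pmf.expectation (if b then planted_cube n S else uniform_cube n) (indicator E))"
    unfolding clique_dist_def by (rule expectation_bind_pmf[where B = 1]) (simp add: indicator_def)
  also have "\<dots> = (1 - card S / n) * measure_pmf.prob (uniform_cube n) E
      + card S / n * measure_pmf.prob (planted_cube n S) E"
    using assms by (subst integral_bernoulli_pmf) (auto simp: divide_le_eq_1 mult.commute)
  finally show ?thesis .
qed

text \<open>The strict inequality gives the uniform component positive weight, and this component
  alone already fills the cube.\<close>

lemma set_pmf_clique_dist:
  assumes "card S < n"
  shows "set_pmf (clique_dist n S) = cube n"
proof -
  have "False \<in> set_pmf (bernoulli_pmf (card S / n))"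
    using assms by (simp add: set_pmf_iff)
  thus ?thesis
    using set_pmf_planted_cube[of n S]
    by (auto simp: clique_dist_def set_pmf_uniform_cube split: if_splits)
qed

section \<open>Counting k-subsets and their intersections\<close>

lemma finite_k_subsets: "finite (k_subsets n k)"
  unfolding k_subsets_def by (rule finite_subset[of _ "Pow {1..n}"]) auto

lemma card_k_subsets: "card (k_subsets n k) = n choose k"
  unfolding k_subsets_def using n_subsets[of "{1..n}" k] by simp

text \<open>The ratio of the two binomials is the product of \<open>(k - i) / (n - i)\<close> over
  \<open>i < j\<close>, and each factor is at most \<open>k / n\<close>. Cleared denominators keep
  the induction in the naturals.\<close>

lemma binomial_diff_le:
  assumes "j \<le> k" "k \<le> n"
  shows "((n - j) choose (k - j)) * n ^ j \<le> k ^ j * (n choose k)"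
  using assms(1)
proof (induction j)
  case 0
  show ?case by simp
next
  case (Suc j)
  hence j: "Suc (k - Suc j) = k - j" "Suc (n - Suc j) = n - j" using assms(2) by auto
  have "(n - j) * ((n - Suc j) choose (k - Suc j)) = (k - j) * ((n - j) choose (k - j))"
    using Suc_times_binomial_eq[of "n - Suc j" "k - Suc j"] by (simp add: j mult.commute)
  hence "(n - j) * (((n - Suc j) choose (k - Suc j)) * n ^ Suc j)
      = ((k - j) * n) * (((n - j) choose (k - j)) * n ^ j)"
    by simp
  also have "\<dots> \<le> (k * (n - j)) * (k ^ j * (n choose k))"
  proof (rule mult_le_mono)
    show "(k - j) * n \<le> k * (n - j)"
      using assms(2) by (simp add: diff_mult_distrib diff_mult_distrib2 diff_le_mono2)
    show "((n - j) choose (k - j)) * n ^ j \<le> k ^ j * (n choose k)"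
      using Suc by simp
  qed
  also have "\<dots> = (n - j) * (k ^ Suc j * (n choose k))"
    by simp
  finally show ?case
    using j by simp
qed

text \<open>Removing \<open>W\<close> injects these supersets into the subsets of size
  \<open>k - card W\<close> of the complement. In effect, a random k-subset contains
  \<open>W\<close> with probability at most \<open>(k / n) ^ card W\<close>.\<close>

lemma card_k_subsets_superset_le:
  assumes W: "W \<subseteq> {1..n}" "card W \<le> k" and "1 \<le> n" "k \<le> n"
  shows "real (card {T \<in> k_subsets n k. W \<subseteq> T}) \<le> (k / n) ^ card W * (n choose k)"
proof -
  have fin: "finite W" using W finite_subset by blast
  have "card {T \<in> k_subsets n k. W \<subseteq> T} \<le> card {B. B \<subseteq> {1..n} - W \<and> card B = k - card W}"
  proof (rule card_inj_on_le[where f = "\<lambda>T. T - W"])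
    show "inj_on (\<lambda>T. T - W) {T \<in> k_subsets n k. W \<subseteq> T}"
      by (rule inj_onI) blast
    show "(\<lambda>T. T - W) ` {T \<in> k_subsets n k. W \<subseteq> T} \<subseteq> {B. B \<subseteq> {1..n} - W \<and> card B = k - card W}"
      using fin by (auto simp: k_subsets_def card_Diff_subset)
  qed simp
  also have "\<dots> = (n - card W) choose (k - card W)"
    using W fin by (subst n_subsets) (auto simp: card_Diff_subset)
  finally have "card {T \<in> k_subsets n k. W \<subseteq> T} * n ^ card W \<le> k ^ card W * (n choose k)"
    using binomial_diff_le[OF W(2) assms(4)] by (meson le_trans mult_le_mono1)
  hence "real (card {T \<in> k_subsets n k. W \<subseteq> T}) * real n ^ card W
      \<le> real k ^ card W * real (n choose k)"
    by (metis of_nat_le_iff of_nat_mult of_nat_power)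
  thus ?thesis
    using \<open>1 \<le> n\<close> by (simp add: power_divide pos_le_divide_eq)
qed

text \<open>\<open>2 ^ card (S \<inter> T)\<close> counts the \<open>W \<subseteq> S\<close> with
  \<open>W \<subseteq> T\<close>. After exchanging the sums, the superset bound and the binomial
  expansion over \<open>Pow S\<close> give \<open>(1 + k / n) ^ k\<close>.\<close>

lemma sum_power_card_Int_le:
  assumes S: "S \<in> k_subsets n k" and "1 \<le> n" "k\<^sup>2 \<le> n"
  shows "(\<Sum>T\<in>k_subsets n k. 2 ^ card (S \<inter> T)) \<le> exp 1 * real (n choose k)"
proof -
  have S': "S \<subseteq> {1..n}" "card S = k" "finite S"
    using S finite_subset by (auto simp: k_subsets_def)
  have k: "k \<le> n" using card_mono[of "{1..n}" S] S' by simp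
  have "(\<Sum>T\<in>k_subsets n k. 2 ^ card (S \<inter> T))
      = (\<Sum>T\<in>k_subsets n k. \<Sum>W\<in>Pow S. of_bool (W \<subseteq> T) :: real)"
  proof (rule sum.cong)
    fix T
    have "Pow S \<inter> {W. W \<subseteq> T} = Pow (S \<inter> T)" by blast
    thus "2 ^ card (S \<inter> T) = (\<Sum>W\<in>Pow S. of_bool (W \<subseteq> T) :: real)"
      using S'(3) by (simp add: sum_of_bool_eq card_Pow del: Pow_Int_eq)
  qed simp
  also have "\<dots> = (\<Sum>W\<in>Pow S. \<Sum>T\<in>k_subsets n k. of_bool (W \<subseteq> T))"
    by (rule sum.swap)
  also have "\<dots> = (\<Sum>W\<in>Pow S. real (card {T \<in> k_subsets n k. W \<subseteq> T}))"
    by (simp add: sum_of_bool_eq finite_k_subsets Int_def)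
  also have "\<dots> \<le> (\<Sum>W\<in>Pow S. (k / n) ^ card W * (n choose k))"
    using S' card_mono[OF S'(3)] \<open>1 \<le> n\<close> k by (intro sum_mono card_k_subsets_superset_le) auto
  also have "\<dots> = (1 + k / n) ^ k * (n choose k)"
    using prod_add[OF S'(3), of "\<lambda>_. k / n" "\<lambda>_. 1"] S'(2)
    by (simp add: add.commute flip: sum_distrib_right)
  also have "(1 + k / n) ^ k \<le> exp (k / n) ^ k"
    by (intro power_mono exp_ge_add_one_self) simp
  also have "\<dots> = exp (k\<^sup>2 / n)"
    by (simp add: power2_eq_square flip: exp_of_nat_mult)
  also have "\<dots> \<le> exp 1"
    using \<open>1 \<le> n\<close> \<open>k\<^sup>2 \<le> n\<close> by (simp add: divide_le_eq_1 flip: of_nat_power)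
  finally show ?thesis by (simp add: mult_right_mono)
qed

section \<open>The query lower bound\<close>

text \<open>Planted densities have mean 1, so the advantage is the correlation of the density with
  the centred indicator of \<open>E\<close>. The Schur test applies, and the centred indicator has
  second moment \<open>p * (1 - p)\<close>.\<close>

lemma sum_planted_advantage_sq_le:
  assumes "1 \<le> n" "k\<^sup>2 \<le> n"
  shows "(\<Sum>S\<in>k_subsets n k.
      (measure_pmf.prob (planted_cube n S) E - measure_pmf.prob (uniform_cube n) E)\<^sup>2)
    \<le> exp 1 * (n choose k)
      * (measure_pmf.prob (uniform_cube n) E * (1 - measure_pmf.prob (uniform_cube n) E))"
proof -
  define U where "U = uniform_cube n"
  define p where "p = measure_pmf.prob U E"
  have fin: "finite (set_pmf U)" by (simp add: U_def set_pmf_uniform_cube finite_cube)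
  have int: "integrable (measure_pmf U) f" for f :: "bitvec \<Rightarrow> real"
    by (rule integrable_measure_pmf_finite[OF fin])
  have k: "k \<le> n" using assms(2) by (metis le_trans power2_nat_le_imp_le order_refl)
  have sub: "S \<subseteq> {1..n}" if "S \<in> k_subsets n k" for S
    using that by (simp add: k_subsets_def)
  have adv: "measure_pmf.prob (planted_cube n S) E - p
      = measure_pmf.expectation U (\<lambda>x. (indicator E x - p) * planted_density S x)"
    if "S \<in> k_subsets n k" for S
  proof -
    have "measure_pmf.prob (planted_cube n S) E
        = measure_pmf.expectation U (\<lambda>x. indicator E x * planted_density S x)"
      using expectation_planted_cube[OF sub[OF that], of "indicator E"] by (simp add: U_def)
    thus ?thesis
      using expectation_planted_density[OF sub[OF that]]
      by (simp add: left_diff_distrib int U_def[symmetric])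
  qed
  have "(\<Sum>S\<in>k_subsets n k. (measure_pmf.prob (planted_cube n S) E - p)\<^sup>2)
      = (\<Sum>S\<in>k_subsets n k.
          (measure_pmf.expectation U (\<lambda>x. (indicator E x - p) * planted_density S x))\<^sup>2)"
    by (simp add: adv)
  also have "\<dots> \<le> (exp 1 * (n choose k)) * measure_pmf.expectation U (\<lambda>x. (indicator E x - p)\<^sup>2)"
  proof (rule sum_correlation_sq_le[OF fin finite_k_subsets])
    show "0 < exp 1 * real (n choose k)" using k by simp
    fix S assume S: "S \<in> k_subsets n k"
    show "0 \<le> measure_pmf.expectation U (\<lambda>x. planted_density S x * planted_density T x)" for T
      by (intro integral_nonneg_AE) (simp add: planted_density_nonneg)
    have "(\<Sum>T\<in>k_subsets n k. measure_pmf.expectation U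
          (\<lambda>x. planted_density S x * planted_density T x))
        = (\<Sum>T\<in>k_subsets n k. 2 ^ card (S \<inter> T))"
      unfolding U_def using sub S by (intro sum.cong expectation_planted_density_mult) auto
    also have "\<dots> \<le> exp 1 * real (n choose k)"
      by (rule sum_power_card_Int_le[OF S assms])
    finally show "(\<Sum>T\<in>k_subsets n k. measure_pmf.expectation U
        (\<lambda>x. planted_density S x * planted_density T x)) \<le> exp 1 * real (n choose k)" .
  qed
  also have "measure_pmf.expectation U (\<lambda>x. (indicator E x - p)\<^sup>2)
      = measure_pmf.expectation U (\<lambda>x. (\<lambda>b. (of_bool b - p)\<^sup>2) (x \<in> E))"
    by (simp add: indicator_def)
  also have "\<dots> = p * (1 - p)"
    by (subst expectation_bool_image_pmf) (simp add: p_def power2_eq_square algebra_simps)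
  finally show ?thesis by (simp add: p_def U_def)
qed

text \<open>Mixing scales the planted advantage by \<open>k / n\<close>. As
  \<open>k / n \<le> 1 / 2\<close>, both answer probabilities keep at least half their uniform
  value, whence the factor 4.\<close>

lemma sum_chi_square_clique_le:
  assumes "1 \<le> k" "k\<^sup>2 \<le> n" "2 * k \<le> n"
  shows "(\<Sum>S\<in>k_subsets n k.
      (measure_pmf.prob (clique_dist n S) E - measure_pmf.prob (uniform_cube n) E)\<^sup>2
      / (measure_pmf.prob (clique_dist n S) E * (1 - measure_pmf.prob (clique_dist n S) E)))
    \<le> 4 * exp 1 * (k / n)\<^sup>2 * (n choose k)"
proof -
  define p where "p = measure_pmf.prob (uniform_cube n) E"
  define r where "r S = measure_pmf.prob (planted_cube n S) E" for S
  define c where "c S = measure_pmf.prob (clique_dist n S) E" for S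
  define \<kappa> where "\<kappa> = k / n"
  have n: "1 \<le> n" using assms by simp
  have \<kappa>: "0 \<le> \<kappa>" "\<kappa> \<le> 1 / 2" using assms n by (simp_all add: \<kappa>_def field_simps)
  have p: "0 \<le> p" "p \<le> 1" and r: "0 \<le> r S" "r S \<le> 1" for S
    by (simp_all add: p_def r_def)
  have c: "c S = (1 - \<kappa>) * p + \<kappa> * r S" if "S \<in> k_subsets n k" for S
    using that assms prob_clique_dist[of S n E] by (simp add: k_subsets_def c_def p_def r_def \<kappa>_def)
  show ?thesis
  proof (cases "p = 0 \<or> p = 1")
    \<comment> \<open>The variance \<open>p * (1 - p)\<close> vanishes here, but equal supports
      force \<open>c S = p\<close>, so every summand is zero.\<close>
    case True
    have "c S = p" if "S \<in> k_subsets n k" for S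
    proof -
      have "set_pmf (clique_dist n S) = set_pmf (uniform_cube n)"
        using that assms n by (simp add: k_subsets_def set_pmf_clique_dist set_pmf_uniform_cube)
      from prob_eq_0_or_1_cong[OF this, of E] True show ?thesis
        unfolding c_def p_def by metis
    qed
    thus ?thesis by (simp add: c_def p_def)
  next
    case False
    hence pq: "0 < p * (1 - p)" using p by (simp add: less_le)
    have "(\<Sum>S\<in>k_subsets n k. (c S - p)\<^sup>2 / (c S * (1 - c S)))
        \<le> (\<Sum>S\<in>k_subsets n k. 4 * \<kappa>\<^sup>2 / (p * (1 - p)) * (r S - p)\<^sup>2)"
    proof (rule sum_mono)
      fix S assume S: "S \<in> k_subsets n k"
      have "c S - p = \<kappa> * (r S - p)" by (simp add: c[OF S] algebra_simps)
      hence sq: "(c S - p)\<^sup>2 = \<kappa>\<^sup>2 * (r S - p)\<^sup>2" by (simp add: power_mult_distrib)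
      have "1 / 2 * p \<le> (1 - \<kappa>) * p"
        using \<kappa> p by (intro mult_right_mono) auto
      moreover have "0 \<le> \<kappa> * r S" using \<kappa> r by simp
      ultimately have c1: "p / 2 \<le> c S" unfolding c[OF S] by linarith
      have "1 / 2 * (1 - p) \<le> (1 - \<kappa>) * (1 - p)"
        using \<kappa> p by (intro mult_right_mono) auto
      moreover have "0 \<le> \<kappa> * (1 - r S)" using \<kappa> r by simp
      moreover have "1 - c S = (1 - \<kappa>) * (1 - p) + \<kappa> * (1 - r S)"
        by (simp add: c[OF S] algebra_simps)
      ultimately have c2: "(1 - p) / 2 \<le> 1 - c S" by linarith
      have le: "p / 2 * ((1 - p) / 2) \<le> c S * (1 - c S)"
        using c1 c2 p by (intro mult_mono) auto
      hence "(c S - p)\<^sup>2 / (c S * (1 - c S)) \<le> (c S - p)\<^sup>2 / (p / 2 * ((1 - p) / 2))"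
      proof (rule divide_left_mono)
        show "0 < c S * (1 - c S) * (p / 2 * ((1 - p) / 2))"
          using pq le by (intro mult_pos_pos[of "c S * _"]) simp_all
      qed simp
      also have "\<dots> = 4 * \<kappa>\<^sup>2 / (p * (1 - p)) * (r S - p)\<^sup>2" by (simp add: sq)
      finally show "(c S - p)\<^sup>2 / (c S * (1 - c S)) \<le> 4 * \<kappa>\<^sup>2 / (p * (1 - p)) * (r S - p)\<^sup>2" .
    qed
    also have "\<dots> = 4 * \<kappa>\<^sup>2 / (p * (1 - p)) * (\<Sum>S\<in>k_subsets n k. (r S - p)\<^sup>2)"
      by (simp add: sum_distrib_left)
    also have "\<dots> \<le> 4 * \<kappa>\<^sup>2 / (p * (1 - p)) * (exp 1 * (n choose k) * (p * (1 - p)))"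
      using pq sum_planted_advantage_sq_le[OF n assms(2), of E]
      by (intro mult_left_mono) (simp_all add: r_def p_def)
    also have "\<dots> = 4 * exp 1 * \<kappa>\<^sup>2 * (n choose k)" using False by simp
    finally show ?thesis by (simp add: c_def p_def \<kappa>_def)
  qed
qed

lemma clique_query_lower_bound:
  assumes k: "1 \<le> k" "k\<^sup>2 \<le> n" "2 * k \<le> n"
    and A: "solves_clique n k (2 / 3) A"
    and q: "\<And>S r. S \<in> k_subsets n k \<Longrightarrow> r \<in> set_pmf (run (clique_dist n S) A) \<Longrightarrow> snd r \<le> q"
  shows "(ln (3 / 2) - ln 2 / 2) / (4 * exp 1) * ((real n)\<^sup>2 / (real k)\<^sup>2) \<le> real q"
proof -
  define U where "U = uniform_cube n"
  define m where "m = real (n choose k)"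
  \<comment> \<open>The test weight penalises the correct output. Success probability 2/3 makes its
    mean under the planted distribution at most \<open>1 - 1/2 * 2/3 = 2/3\<close>; under
    \<open>U\<close> the mean of \<open>ln w\<close> is \<open>- ln 2\<close> times the chance of
    outputting \<open>S\<close>.\<close>
  define w :: "nat set \<Rightarrow> nat set \<Rightarrow> real" where "w S T = (if T = S then 1 / 2 else 1)" for S T
  define out where "out D = map_pmf fst (run D A)" for D
  have n: "2 \<le> n" "k < n" using k by linarith+
  \<comment> \<open>At least two candidate sets exist, so blind guessing, worth \<open>ln 2\<close>
    in total over all \<open>S\<close>, costs at most \<open>ln 2 / 2\<close> per set.\<close>
  have "n choose 1 \<le> n choose k"
    using k by (intro binomial_mono) auto
  hence m: "2 \<le> m" using n by (simp add: m_def)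
  have supp: "set_pmf (clique_dist n S) = set_pmf U" if "S \<in> k_subsets n k" for S
    using that n by (simp add: U_def k_subsets_def set_pmf_clique_dist set_pmf_uniform_cube)
  have "k_subsets n k \<noteq> {}"
    using card_k_subsets[of n k] n by auto
  then obtain S\<^sub>0 where S0: "S\<^sub>0 \<in> k_subsets n k" by blast
  have qU: "snd r \<le> q" if "r \<in> set_pmf (run U A)" for r
    using q[OF S0] that set_pmf_run_cong[OF supp[OF S0]] by blast
  have point: "measure_pmf.expectation (run D A) (\<lambda>r. if fst r = S then a else b)
      = b + (a - b) * pmf (out D) S" for D S and a b :: real
    using expectation_bool_image_pmf[of "out D" "\<lambda>t. if t then a else b" "\<lambda>T. T = S"]
    by (simp add: out_def pmf.rep_eq algebra_simps)
  have gap: "ln (3 / 2) - ln 2 * pmf (out U) S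
      \<le> measure_pmf.expectation (run U A) (\<lambda>r. ln (w S (fst r)))
        - ln (measure_pmf.expectation (run (clique_dist n S) A) (\<lambda>r. w S (fst r)))"
    if S: "S \<in> k_subsets n k" for S
  proof -
    have "2 / 3 \<le> pmf (out (clique_dist n S)) S"
      using A S by (simp add: solves_clique_def out_def)
    hence "ln (1 + (1 / 2 - 1) * pmf (out (clique_dist n S)) S) \<le> ln (2 / 3)"
      using pmf_le_1[of "out (clique_dist n S)" S] by (subst ln_le_cancel_iff) auto
    hence W: "ln (measure_pmf.expectation (run (clique_dist n S) A) (\<lambda>r. w S (fst r))) \<le> ln (2 / 3)"
      by (simp only: w_def point)
    have "measure_pmf.expectation (run U A) (\<lambda>r. ln (w S (fst r)))
        = measure_pmf.expectation (run U A) (\<lambda>r. if fst r = S then - ln 2 else 0)"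
      by (intro Bochner_Integration.integral_cong refl) (simp add: w_def ln_div)
    also have "\<dots> = - ln 2 * pmf (out U) S" by (simp add: point)
    finally show ?thesis using W by (simp add: ln_div)
  qed
  have "(\<Sum>S\<in>k_subsets n k. pmf (out U) S) = measure_pmf.prob (out U) (k_subsets n k)"
    by (simp add: measure_measure_pmf_finite finite_k_subsets)
  hence out_le: "(\<Sum>S\<in>k_subsets n k. pmf (out U) S) \<le> 1" by simp
  have "(ln (3 / 2) - ln 2 / 2) * m \<le> ln (3 / 2) * m - ln 2"
    using m by (simp add: algebra_simps)
  also have "\<dots> \<le> ln (3 / 2) * m - ln 2 * (\<Sum>S\<in>k_subsets n k. pmf (out U) S)"
    using out_le by simp
  also have "\<dots> = (\<Sum>S\<in>k_subsets n k. ln (3 / 2) - ln 2 * pmf (out U) S)"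
    by (simp add: sum_subtractf sum_distrib_left card_k_subsets m_def mult.commute)
  also have "\<dots> \<le> (\<Sum>S\<in>k_subsets n k. measure_pmf.expectation (run U A) (\<lambda>r. ln (w S (fst r)))
        - ln (measure_pmf.expectation (run (clique_dist n S) A) (\<lambda>r. w S (fst r))))"
    by (intro sum_mono gap)
  also have "\<dots> \<le> real q * (4 * exp 1 * (k / n)\<^sup>2 * m)"
    unfolding m_def
    by (rule sum_entropy_gap_le[where a = "1 / 2" and b = 1])
      (auto simp: w_def supp qU U_def[symmetric] sum_chi_square_clique_le[OF k, folded U_def])
  finally have "(ln (3 / 2) - ln 2 / 2) \<le> real q * (4 * exp 1 * (k / n)\<^sup>2)"
    using m by (simp flip: mult.assoc)
  thus ?thesis
    using k n by (simp add: field_simps power_divide)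
qed

theorem theorem2p8:
  fixes \<delta> :: real
  assumes "\<delta> > 0"
  shows "\<exists>c>0. \<exists>(a::nat) (N::nat). \<forall>n\<ge>N. \<forall>k\<ge>1. real k \<le> real n powr (1 / 2 - \<delta>) \<longrightarrow>
           (\<forall>A. solves_clique n k (2 / 3) A \<longrightarrow>
             ereal_of_enat (query_complexity n k A)
               \<ge> ereal (c * ((real n)\<^sup>2 / (real k)\<^sup>2) / ln (real n) ^ a))"
proof -
  define c :: real where "c = (ln (3 / 2) - ln 2 / 2) / (4 * exp 1)"
  \<comment> \<open>Positivity of \<open>c\<close> amounts to \<open>(3/2)^2 > 2\<close>.\<close>
  have "ln 2 < ln ((3 / 2 :: real)\<^sup>2)" by (subst ln_less_cancel_iff) (auto simp: power2_eq_square)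
  hence c: "0 < c" by (simp add: c_def ln_realpow)
  have "ereal (c * ((real n)\<^sup>2 / (real k)\<^sup>2)) \<le> ereal_of_enat (query_complexity n k A)"
    if n: "4 \<le> n" and k: "1 \<le> k" "real k \<le> real n powr (1 / 2 - \<delta>)"
      and A: "solves_clique n k (2 / 3) A" for n k A
  proof (cases "query_complexity n k A")
    case (enat q)
    \<comment> \<open>Since \<delta> is positive, \<open>k\<close> is at most the square root of
      \<open>n\<close>, which is what the row bound of the Gram matrix requires.\<close>
    have "real k \<le> real n powr (1 / 2)"
      using k(2) n assms by (elim order_trans) (intro powr_mono, auto)
    hence "(real k)\<^sup>2 \<le> (sqrt (real n))\<^sup>2" by (intro power_mono) (simp_all add: powr_half_sqrt)
    hence kn: "k\<^sup>2 \<le> n" by (simp flip: of_nat_power)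
    have k2: "2 * k \<le> n"
    proof (cases "k \<le> 2")
      case False
      hence "2 * k \<le> k * k" by (intro mult_le_mono1) simp
      thus ?thesis using kn unfolding power2_eq_square by linarith
    qed (use n in simp)
    have "snd r \<le> q" if "S \<in> k_subsets n k" "r \<in> set_pmf (run (clique_dist n S) A)" for S r
    proof -
      have "enat (snd r) \<le> query_complexity n k A"
        unfolding query_complexity_def by (rule SUP_upper2[OF that(1)], rule SUP_upper[OF that(2)])
      thus ?thesis by (simp add: enat)
    qed
    from clique_query_lower_bound[OF k(1) kn k2 A this] show ?thesis
      by (simp add: enat c_def)
  qed simp
  thus ?thesis
    \<comment> \<open>The exponent \<open>a = 0\<close> records that no logarithmic factor is lost;
      \<open>N = 4\<close> covers \<open>2 * k \<le> n\<close> when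
      \<open>k \<le> 2\<close>.\<close>
    using c by (intro exI[of _ c] exI[of _ 0] exI[of _ 4] conjI) (simp_all del: times_divide_eq_right)
qed

end
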